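(* Let $C>1$ and $\varepsilon=\min\{C-1,1/3\}$. There are constants $\alpha=\alpha(\varepsilon)>0$, $\Delta_0=\Delta_0(\varepsilon)$ and $\ell_0=\ell_0(\varepsilon)$, depending only on $\varepsilon$, such that for all integers $\Delta>\Delta_0$, every integer $k>C\Delta/\ln\Delta$, every color $c\in[k]$, and every integer $\ell>\ell_0$, $$\mathbf{E}_{\tau\sim\mu_\ell}\Big[\big|\mu_\ell\big(\sigma(\mathrm{root})=c\mid\sigma(L)=\tau(L)\big)-1/k\big|\Big]\le\Delta^{-\alpha\ell}.$$
   Context: $[k]=\{1,\dots,k\}$. $T_\ell=(V_\ell,E_\ell)$ denotes the complete rooted tree of depth $\ell$ in which every non-leaf vertex has exactly $\Delta$ children, and $L=L_\ell$ denotes its set of leaves (the $\Delta^\ell$ vertices at depth $\ell$). A $k$-coloring of $T_\ell$ is a map $\sigma:V_\ell\to[k]$ with $\sigma(v)\ne\sigma(w)$ whenever $(v,w)\in E_\ell$. $\mu_\ell$ is the uniform probability measure on $k$-colorings of $T_\ell$. For a coloring $\sigma$, $\sigma(L)$ denotes its restriction to the leaves. In the conditional probability, $\sigma$ is distributed as $\mu_\ell$. *)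

theory Defs
  imports "HOL-Probability.Probability"
begin

text \<open>
  A vertex of the complete rooted tree is the path leading to it from the root: the list \<open>v\<close>
  records which of the \<open>\<Delta>\<close> children is taken at each step. Its depth is \<open>length v\<close>,
  and the children of a non-leaf \<open>v\<close> are \<open>v @ [0], \<dots>, v @ [\<Delta> - 1]\<close>.
\<close>

definition tree_verts :: "nat \<Rightarrow> nat \<Rightarrow> nat list set" where
  "tree_verts \<Delta> l = {v. set v \<subseteq> {..<\<Delta>} \<and> length v \<le> l}"

definition tree_edges :: "nat \<Rightarrow> nat \<Rightarrow> (nat list \<times> nat list) set" where
  "tree_edges \<Delta> l = {(v, v @ [i]) | v i. v \<in> tree_verts \<Delta> l \<and> length v < l \<and> i < \<Delta>}"

definition tree_root :: "nat list" where
  "tree_root = []"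

definition tree_leaves :: "nat \<Rightarrow> nat \<Rightarrow> nat list set" where
  "tree_leaves \<Delta> l = {v \<in> tree_verts \<Delta> l. length v = l}"

text \<open>
  Colorings are extensional functions on the vertex set, so that distinct elements of the set
  below are distinct colorings.
\<close>

definition tree_colorings :: "nat \<Rightarrow> nat \<Rightarrow> nat \<Rightarrow> (nat list \<Rightarrow> nat) set" where
  "tree_colorings \<Delta> k l =
     {\<sigma> \<in> tree_verts \<Delta> l \<rightarrow>\<^sub>E {1..k}. \<forall>(v, w) \<in> tree_edges \<Delta> l. \<sigma> v \<noteq> \<sigma> w}"

lemma finite_tree_colorings: "finite (tree_colorings \<Delta> k l)"
proof -
  have "finite (tree_verts \<Delta> l)"
    unfolding tree_verts_def by (rule finite_lists_length_le) simp
  then have "finite (tree_verts \<Delta> l \<rightarrow>\<^sub>E {1..k})"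
    by (intro finite_PiE) auto
  then show ?thesis
    unfolding tree_colorings_def by (rule rev_finite_subset) auto
qed

lemma tree_colorings_nonempty:
  assumes "2 \<le> k"
  shows "tree_colorings \<Delta> k l \<noteq> {}"
proof -
  have "(\<lambda>v \<in> tree_verts \<Delta> l. if even (length v) then 1 else 2) \<in> tree_colorings \<Delta> k l"
    using assms
    by (auto simp: tree_colorings_def tree_edges_def tree_verts_def)
  then show ?thesis by blast
qed

text \<open>
  \<open>pmf_of_set\<close> is the uniform distribution on finite nonempty sets only. By the two lemmas
  above this is the case for \<open>k \<ge> 2\<close>, and \<open>k > C \<Delta> / ln \<Delta>\<close> with \<open>C > 1\<close>, \<open>\<Delta> \<ge> 2\<close>
  even forces \<open>k \<ge> 3\<close>, as \<open>x / ln x \<ge> exp 1\<close> for all \<open>x > 1\<close>.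
\<close>

definition coloring_pmf :: "nat \<Rightarrow> nat \<Rightarrow> nat \<Rightarrow> (nat list \<Rightarrow> nat) pmf" where
  "coloring_pmf \<Delta> k l = pmf_of_set (tree_colorings \<Delta> k l)"

definition root_marginal :: "nat \<Rightarrow> nat \<Rightarrow> nat \<Rightarrow> nat \<Rightarrow> (nat list \<Rightarrow> nat) \<Rightarrow> real" where
  "root_marginal \<Delta> k l c \<tau> =
     \<P>(\<sigma> in measure_pmf (coloring_pmf \<Delta> k l). \<sigma> tree_root = c
         \<bar> restrict \<sigma> (tree_leaves \<Delta> l) = restrict \<tau> (tree_leaves \<Delta> l))"

end

theory Submission
  imports Defs "HOL-Combinatorics.Transposition"
begin

text \<open>
  Let \<open>a j\<close> be the law of the leaf coloring given root color \<open>j\<close>, and measure the information of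
  the leaves about the root by the chi-square divergence \<open>\<chi>\<close> of \<open>a j\<close> from the average
  (\<open>mixture\<close>) of these laws over the \<open>k\<close> colors. By Cauchy-Schwarz, the expected deviation of the
  root marginal from \<open>1 / k\<close> is at most \<open>sqrt \<chi> / k\<close> (\<open>sum_abs_deviation_le\<close>,
  \<open>expectation_root_marginal\<close>).

  The heart of the proof is the one-level inequality
  \<open>\<chi>' \<le> 4 * ((1 + \<chi> / (k - 1)\<^sup>2) ^ \<Delta> - 1)\<close> (\<open>chi_sq_broadcast\<close>). Compare the laws of the
  \<open>\<Delta>\<close> independent subtrees with the \<open>\<Delta>\<close>-fold product of the mixture. The likelihood \<open>W\<^sub>j\<close> of
  root color \<open>j\<close> is a product over the children of factors with mean \<open>1\<close> and variance
  \<open>\<chi> / (k - 1)\<^sup>2\<close>, which gives \<open>V = (1 + \<chi> / (k - 1)\<^sup>2) ^ \<Delta> - 1\<close> for its variance. The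
  divergence \<open>\<chi>'\<close> is the mean of the empirical variance of the \<open>W\<^sub>j\<close> divided by their average. That
  average is close to \<open>1\<close>: the posterior probabilities of two colors are negatively correlated, because
  posteriors add up to \<open>1\<close> and the colors are exchangeable, hence so are \<open>W\<^sub>i\<close> and \<open>W\<^sub>j\<close>, and the
  average has variance at most \<open>V / k\<close>. So small a variance compensates for the trivial bound,
  of order \<open>k\<close>, on the rare event that the average is below \<open>1 / 2\<close>
  (\<open>mean_deviation_bound\<close>).

  At depth \<open>0\<close> the leaves determine the root and \<open>\<chi> = k - 1\<close>. By convexity of the exponential, each
  level multiplies the bound by \<open>\<rho> = 4 / (k - 1) * (exp (\<Delta> / (k - 1)) - 1)\<close>
  (\<open>chi_sq_leaf_law_bound\<close>). If \<open>k > (1 + \<epsilon>) * \<Delta> / ln \<Delta>\<close> and \<open>\<Delta>\<close> is large, then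
  \<open>\<rho> \<le> \<Delta> powr (- \<epsilon> / 4)\<close> (\<open>contraction_factor_bound\<close>). The square root of \<open>\<rho> ^ l\<close> is the
  claimed bound with \<open>\<alpha> = \<epsilon> / 8\<close>.
\<close>

section \<open>Channels, their mixture and the overlap matrix\<close>

definition mixture :: "'c set \<Rightarrow> ('c \<Rightarrow> 'b \<Rightarrow> real) \<Rightarrow> 'b \<Rightarrow> real" where
  "mixture K a b = (\<Sum>j\<in>K. a j b) / real (card K)"

text \<open>
  With the root uniform on \<open>K\<close>, the observation \<open>b\<close> has the law \<open>mixture K a\<close>, and the posterior
  of the root is \<open>p\<^sub>j = a j b / (card K * mixture K a b)\<close>. The overlap is
  \<open>(card K)\<^sup>2\<close> times the mean of \<open>p\<^sub>i p\<^sub>j\<close>. Where the mixture vanishes, so does every \<open>a j\<close>, and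
  the quotient \<open>0 / 0 = 0\<close> is the right value.
\<close>

definition overlap :: "'c set \<Rightarrow> 'b set \<Rightarrow> ('c \<Rightarrow> 'b \<Rightarrow> real) \<Rightarrow> 'c \<Rightarrow> 'c \<Rightarrow> real" where
  "overlap K B a i j = (\<Sum>b\<in>B. a i b * a j b / mixture K a b)"

text \<open>
  This is the average over \<open>j\<close> of the chi-square divergence of the law \<open>a j\<close> from the mixture
  (see \<open>overlap_diag_expand\<close>).
\<close>

definition chi_sq :: "'c set \<Rightarrow> 'b set \<Rightarrow> ('c \<Rightarrow> 'b \<Rightarrow> real) \<Rightarrow> real" where
  "chi_sq K B a = (\<Sum>j\<in>K. overlap K B a j j) / real (card K) - 1"

text \<open>
  A child of a vertex with color \<open>j\<close> is uniform on the other colors, so the subtree of the child is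
  observed through this law.
\<close>

definition avoiding :: "'c set \<Rightarrow> ('c \<Rightarrow> 'b \<Rightarrow> real) \<Rightarrow> 'c \<Rightarrow> 'b \<Rightarrow> real" where
  "avoiding K a j b = (\<Sum>m\<in>K - {j}. a m b) / (real (card K) - 1)"

definition broadcast ::
    "'c set \<Rightarrow> nat \<Rightarrow> ('c \<Rightarrow> 'b \<Rightarrow> real) \<Rightarrow> 'c \<Rightarrow> (nat \<Rightarrow> 'b) \<Rightarrow> real" where
  "broadcast K D a j f = (\<Prod>i<D. avoiding K a j (f i))"

locale channel =
  fixes K :: "'c set" and B :: "'b set" and a :: "'c \<Rightarrow> 'b \<Rightarrow> real"
  assumes finite_K: "finite K" and card_K: "2 \<le> card K" and finite_B: "finite B"
    and nonneg: "\<And>j b. j \<in> K \<Longrightarrow> b \<in> B \<Longrightarrow> 0 \<le> a j b"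
    and total: "\<And>j. j \<in> K \<Longrightarrow> (\<Sum>b\<in>B. a j b) = 1"
begin

lemma card_K_real: "2 \<le> real (card K)"
  using card_K by simp

lemma sum_eq_mixture: "(\<Sum>j\<in>K. a j b) = real (card K) * mixture K a b"
  using card_K by (simp add: mixture_def)

lemma mixture_nonneg: "b \<in> B \<Longrightarrow> 0 \<le> mixture K a b"
  by (simp add: mixture_def sum_nonneg nonneg)

lemma mixture_zero_imp: "b \<in> B \<Longrightarrow> mixture K a b = 0 \<Longrightarrow> j \<in> K \<Longrightarrow> a j b = 0"
  using sum_eq_mixture[of b] sum_nonneg_eq_0_iff[OF finite_K, of "\<lambda>j. a j b"] nonneg by auto

lemma mixture_total: "(\<Sum>b\<in>B. mixture K a b) = 1"
proof -
  have "(\<Sum>b\<in>B. mixture K a b) = (\<Sum>j\<in>K. \<Sum>b\<in>B. a j b) / real (card K)"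
    by (subst sum.swap) (simp add: mixture_def sum_divide_distrib)
  also have "\<dots> = 1"
    using card_K by (simp add: total)
  finally show ?thesis .
qed

text \<open>
  Posteriors add up to one. This is what makes different colors negatively correlated.
\<close>

lemma overlap_row_sum:
  assumes "i \<in> K"
  shows "(\<Sum>j\<in>K. overlap K B a i j) = real (card K)"
proof -
  have "(\<Sum>j\<in>K. overlap K B a i j) = (\<Sum>b\<in>B. a i b * (\<Sum>j\<in>K. a j b) / mixture K a b)"
    unfolding overlap_def by (subst sum.swap) (simp add: sum_distrib_left sum_divide_distrib)
  also have "\<dots> = (\<Sum>b\<in>B. real (card K) * a i b)"
    using mixture_zero_imp assms by (intro sum.cong refl) (auto simp: sum_eq_mixture)
  also have "\<dots> = real (card K)"
    using assms by (simp add: total flip: sum_distrib_left)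
  finally show ?thesis .
qed

lemma overlap_diag_expand:
  assumes "j \<in> K"
  shows "(\<Sum>b\<in>B. (a j b - mixture K a b)\<^sup>2 / mixture K a b) = overlap K B a j j - 1"
proof -
  have "(\<Sum>b\<in>B. (a j b - mixture K a b)\<^sup>2 / mixture K a b)
      = (\<Sum>b\<in>B. a j b * a j b / mixture K a b - 2 * a j b + mixture K a b)"
  proof (intro sum.cong refl)
    fix b assume b: "b \<in> B"
    show "(a j b - mixture K a b)\<^sup>2 / mixture K a b
        = a j b * a j b / mixture K a b - 2 * a j b + mixture K a b"
      using mixture_zero_imp[OF b _ assms]
      by (cases "mixture K a b = 0")
         (auto simp: power2_eq_square algebra_simps add_divide_distrib diff_divide_distrib)
  qed
  also have "\<dots> = overlap K B a j j - 1"
    using assms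
    by (simp add: overlap_def sum.distrib sum_subtractf total mixture_total flip: sum_distrib_left)
  finally show ?thesis .
qed

lemma overlap_diag_ge_1:
  assumes "j \<in> K"
  shows "1 \<le> overlap K B a j j"
proof -
  have "0 \<le> (\<Sum>b\<in>B. (a j b - mixture K a b)\<^sup>2 / mixture K a b)"
    by (intro sum_nonneg divide_nonneg_nonneg mixture_nonneg) auto
  then show ?thesis using overlap_diag_expand[OF assms] by simp
qed

lemma avoiding_eq:
  assumes "j \<in> K"
  shows "avoiding K a j b = (real (card K) * mixture K a b - a j b) / (real (card K) - 1)"
  using assms finite_K by (simp add: avoiding_def sum_diff1 sum_eq_mixture)

lemma avoiding_nonneg: "b \<in> B \<Longrightarrow> 0 \<le> avoiding K a j b"
  unfolding avoiding_def using card_K by (intro divide_nonneg_nonneg sum_nonneg nonneg) auto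

lemma avoiding_total:
  assumes "j \<in> K"
  shows "(\<Sum>b\<in>B. avoiding K a j b) = 1"
proof -
  have "(\<Sum>b\<in>B. avoiding K a j b)
      = (real (card K) * (\<Sum>b\<in>B. mixture K a b) - (\<Sum>b\<in>B. a j b)) / (real (card K) - 1)"
    using assms
    by (simp add: avoiding_eq sum_subtractf sum_distrib_left flip: sum_divide_distrib)
  then show ?thesis
    using assms card_K by (simp add: mixture_total total)
qed

text \<open>
  Since \<open>avoiding K a j\<close> is an affine function of \<open>a j\<close>, its overlaps are affine functions of the
  original ones: the deviation from \<open>1\<close> shrinks by \<open>(card K - 1)\<^sup>2\<close>, the square of the second
  eigenvalue \<open>- 1 / (card K - 1)\<close> of the coloring chain.
\<close>

lemma avoiding_overlap:
  assumes "i \<in> K" "j \<in> K"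
  shows "(\<Sum>b\<in>B. avoiding K a i b * avoiding K a j b / mixture K a b)
       = 1 + (overlap K B a i j - 1) / (real (card K) - 1)\<^sup>2"
proof -
  let ?k = "real (card K)" and ?m = "mixture K a"
  have "(\<Sum>b\<in>B. avoiding K a i b * avoiding K a j b / ?m b)
      = (\<Sum>b\<in>B. (?k\<^sup>2 * ?m b - ?k * a i b - ?k * a j b + a i b * a j b / ?m b) / (?k - 1)\<^sup>2)"
  proof (intro sum.cong refl)
    fix b assume b: "b \<in> B"
    show "avoiding K a i b * avoiding K a j b / ?m b
        = (?k\<^sup>2 * ?m b - ?k * a i b - ?k * a j b + a i b * a j b / ?m b) / (?k - 1)\<^sup>2"
    proof (cases "?m b = 0")
      case True
      then show ?thesis using mixture_zero_imp[OF b True] assms by simp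
    next
      case False
      have numer: "(?k * ?m b - a i b) * (?k * ?m b - a j b) / ?m b
          = ?k\<^sup>2 * ?m b - ?k * a i b - ?k * a j b + a i b * a j b / ?m b"
        using False by (simp add: field_simps power2_eq_square)
      have "avoiding K a i b * avoiding K a j b / ?m b
          = (?k * ?m b - a i b) * (?k * ?m b - a j b) / ?m b / (?k - 1)\<^sup>2"
        using assms by (simp add: avoiding_eq power2_eq_square)
      also note numer
      finally show ?thesis .
    qed
  qed
  also have "\<dots> = (?k\<^sup>2 - ?k - ?k + overlap K B a i j) / (?k - 1)\<^sup>2"
    using assms
    by (simp add: sum.distrib sum_subtractf mixture_total total overlap_def
             flip: sum_divide_distrib sum_distrib_left)
  also have "\<dots> = 1 + (overlap K B a i j - 1) / (?k - 1)\<^sup>2"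
  proof -
    have "?k\<^sup>2 - ?k - ?k + overlap K B a i j = (?k - 1)\<^sup>2 + (overlap K B a i j - 1)"
      by (simp add: power2_eq_square algebra_simps)
    moreover have "(?k - 1)\<^sup>2 \<noteq> 0" using card_K_real by simp
    ultimately show ?thesis by (metis add_divide_distrib divide_self)
  qed
  finally show ?thesis .
qed

end

section \<open>One level of the tree contracts the divergence\<close>

lemma sum_prod_PiE:
  fixes g :: "'b \<Rightarrow> real"
  assumes "finite B"
  shows "(\<Sum>f \<in> {..<D::nat} \<rightarrow>\<^sub>E B. \<Prod>i<D. g (f i)) = (\<Sum>b\<in>B. g b) ^ D"
  using assms prod_sum_PiE[of "{..<D}" "\<lambda>_. B" "\<lambda>_. g"] by simp

text \<open>
  Here \<open>w j\<close> is the probability of an observation of the whole tree under the root color \<open>j\<close>, and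
  \<open>r\<close> its probability under the reference measure. The left-hand side has the mixture \<open>m\<close> in the
  denominator, the right-hand side has only \<open>r\<close>, so that it becomes a sum of products of
  one-child quantities. If \<open>m\<close> is at least \<open>r / 2\<close>, replacing \<open>m\<close> by \<open>r\<close> costs a factor of two
  in the variance. Otherwise \<open>m\<close> deviates from \<open>r\<close> by at least \<open>r / 2\<close>, and the trivial bound
  \<open>s \<le> card K * m\<^sup>2\<close> is paid for by the second term. That term carries the large factor \<open>card K\<close>;
  it is affordable because averaging over colors that are not positively correlated divides the
  variance of the mixture by \<open>card K\<close>.
\<close>

lemma mean_deviation_bound:
  fixes K :: "'c set" and w :: "'c \<Rightarrow> real" and r :: real
  defines "m \<equiv> (\<Sum>j\<in>K. w j) / real (card K)"
  defines "s \<equiv> (\<Sum>j\<in>K. (w j)\<^sup>2) / real (card K)"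
  assumes K: "finite K" "K \<noteq> {}" and w: "\<And>j. j \<in> K \<Longrightarrow> 0 \<le> w j"
    and r: "0 \<le> r" and r0: "\<And>j. j \<in> K \<Longrightarrow> r = 0 \<Longrightarrow> w j = 0"
  shows "s / m - m
       \<le> 2 * (s / r - m\<^sup>2 / r) + 2 * real (card K) * (m\<^sup>2 / r - 2 * m + r)"
proof (cases "r = 0 \<or> m = 0")
  case True
  have kpos: "real (card K) > 0" using K by (simp add: card_gt_0_iff)
  have "w j = 0" if "j \<in> K" for j
    using True
  proof
    assume "m = 0"
    then have "(\<Sum>j\<in>K. w j) = 0" using kpos by (simp add: m_def)
    then show ?thesis using sum_nonneg_eq_0_iff[OF K(1), of w] w that by auto
  qed (use r0 that in auto)
  then have "m = 0" "s = 0" by (auto simp: m_def s_def)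
  then show ?thesis using r by simp
next
  case False
  define k where "k = real (card K)"
  have kpos: "k > 0" using K by (simp add: k_def card_gt_0_iff)
  have rpos: "r > 0" using False r by simp
  have m0: "0 \<le> m" unfolding m_def by (intro divide_nonneg_nonneg sum_nonneg w) auto
  have mpos: "m > 0" using False m0 by simp
  have sum_eq: "(\<Sum>j\<in>K. w j) = k * m" using kpos by (simp add: m_def k_def)
  have var: "m\<^sup>2 \<le> s"
  proof -
    have "0 \<le> (\<Sum>j\<in>K. (w j - m)\<^sup>2)" by (intro sum_nonneg) auto
    also have "\<dots> = (\<Sum>j\<in>K. (w j)\<^sup>2) - 2 * m * (\<Sum>j\<in>K. w j) + k * m\<^sup>2"
      by (simp add: power2_diff sum.distrib sum_subtractf k_def mult_ac
            flip: sum_distrib_left sum_distrib_right)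
    also have "\<dots> = k * (s - m\<^sup>2)"
      using kpos unfolding sum_eq by (simp add: s_def k_def field_simps power2_eq_square)
    finally show ?thesis using kpos by (simp add: zero_le_mult_iff)
  qed
  have peak: "s \<le> k * m\<^sup>2"
  proof -
    have "(\<Sum>j\<in>K. (w j)\<^sup>2) \<le> (\<Sum>j\<in>K. w j * (k * m))"
      unfolding power2_eq_square
      by (intro sum_mono mult_left_mono w) (use K w member_le_sum[of _ K w] sum_eq in auto)
    also have "\<dots> = k * m * (k * m)" by (simp add: sum_eq flip: sum_distrib_right)
    finally show ?thesis using kpos by (simp add: s_def k_def field_simps power2_eq_square)
  qed
  have expand: "m\<^sup>2 / r - 2 * m + r = (m - r)\<^sup>2 / r"
    using rpos by (simp add: field_simps power2_eq_square)
  have lhs: "s / m - m = (s - m\<^sup>2) / m"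
    using mpos by (simp add: field_simps power2_eq_square)
  have nonneg1: "0 \<le> 2 * (s / r - m\<^sup>2 / r)"
    using var rpos by (simp add: divide_right_mono)
  have nonneg2: "0 \<le> 2 * k * ((m - r)\<^sup>2 / r)"
    using kpos rpos by simp
  have "s / m - m \<le> 2 * (s / r - m\<^sup>2 / r) + 2 * k * ((m - r)\<^sup>2 / r)"
  proof (cases "r \<le> 2 * m")
    case True
    have "(s - m\<^sup>2) / m \<le> (s - m\<^sup>2) / (r / 2)"
      using True var rpos mpos by (intro divide_left_mono) auto
    also have "\<dots> = 2 * (s / r - m\<^sup>2 / r)"
      by (simp add: diff_divide_distrib algebra_simps)
    finally show ?thesis using nonneg2 lhs by linarith
  next
    case False
    have "s / m - m \<le> k * m"
    proof -
      have "s / m \<le> k * m\<^sup>2 / m"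
        using peak mpos by (intro divide_right_mono) auto
      also have "\<dots> = k * m" by (simp add: power2_eq_square)
      finally show ?thesis using mpos by linarith
    qed
    also have "\<dots> \<le> k * (r / 2)" using False kpos by (intro mult_left_mono) auto
    also have "\<dots> = 2 * k * ((r / 2)\<^sup>2 / r)" using rpos by (simp add: power2_eq_square)
    also have "\<dots> \<le> 2 * k * ((m - r)\<^sup>2 / r)"
    proof -
      have "(r / 2)\<^sup>2 \<le> (r - m)\<^sup>2" using False rpos by (intro power_mono) auto
      then show ?thesis
        using kpos rpos by (intro mult_left_mono divide_right_mono) (auto simp: power2_commute)
    qed
    finally show ?thesis using nonneg1 by linarith
  qed
  then show ?thesis unfolding expand k_def .
qed

text \<open>
  The part of the symmetry among the colors that the argument uses: the overlap depends on its two
  colors only through whether they are equal.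
\<close>

locale exchangeable_channel = channel +
  assumes overlap_diag_cong:
      "\<And>i j. i \<in> K \<Longrightarrow> j \<in> K \<Longrightarrow> overlap K B a i i = overlap K B a j j"
    and overlap_off_cong:
      "\<And>i j j'. \<lbrakk>i \<in> K; j \<in> K; j' \<in> K; i \<noteq> j; i \<noteq> j'\<rbrakk>
        \<Longrightarrow> overlap K B a i j = overlap K B a i j'"
begin

lemma overlap_diag:
  assumes "j \<in> K"
  shows "overlap K B a j j = 1 + chi_sq K B a"
proof -
  have "(\<Sum>i\<in>K. overlap K B a i i) = (\<Sum>i\<in>K. overlap K B a j j)"
    by (intro sum.cong refl overlap_diag_cong assms)
  then show ?thesis using card_K by (simp add: chi_sq_def)
qed

lemma chi_sq_nonneg: "0 \<le> chi_sq K B a"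
proof -
  have "K \<noteq> {}" using card_K by auto
  then obtain j where "j \<in> K" by blast
  from overlap_diag[OF this] overlap_diag_ge_1[OF this] show ?thesis by simp
qed

text \<open>
  A row of the overlap matrix sums to \<open>card K\<close> and its diagonal entry is at least \<open>1\<close>. The other
  entries are all equal, hence at most \<open>1\<close>.
\<close>

lemma overlap_off_le_1:
  assumes "i \<in> K" "j \<in> K" "i \<noteq> j"
  shows "overlap K B a i j \<le> 1"
proof -
  let ?k = "real (card K)"
  have "?k = overlap K B a i i + (\<Sum>m\<in>K - {i}. overlap K B a i m)"
    by (rule trans[OF overlap_row_sum[OF assms(1), symmetric]
                      sum.remove[OF finite_K assms(1)]])
  also have "(\<Sum>m\<in>K - {i}. overlap K B a i m) = (\<Sum>m\<in>K - {i}. overlap K B a i j)"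
    by (intro sum.cong refl overlap_off_cong[OF assms(1) _ assms(2) _ assms(3)]) auto
  also have "\<dots> = (?k - 1) * overlap K B a i j"
    using assms card_K by (simp add: of_nat_diff)
  finally have row: "?k = overlap K B a i i + (?k - 1) * overlap K B a i j" .
  show ?thesis
  proof (rule ccontr)
    assume "\<not> overlap K B a i j \<le> 1"
    then have off: "(?k - 1) * 1 < (?k - 1) * overlap K B a i j"
      using card_K_real by (intro mult_strict_left_mono) auto
    have False if "n - 1 < p" "n = x + p" "1 \<le> x" for n p x :: real
      using that by linarith
    from this[OF off[unfolded mult_1_right] row overlap_diag_ge_1[OF assms(1)]] show False .
  qed
qed

text \<open>
  Relative to the product of \<open>D\<close> copies of the mixture, the likelihoods \<open>W\<^sub>j\<close> of the root colors
  satisfy \<open>E (W\<^sub>i * W\<^sub>j) = (h i j) ^ D\<close> with \<open>h\<close> the overlaps of \<open>avoiding\<close>. For \<open>i = j\<close> this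
  is \<open>1 + V\<close>, and for \<open>i \<noteq> j\<close> it is at most \<open>1\<close>, so the average of the \<open>W\<^sub>j\<close> has variance at
  most \<open>V / card K\<close>. Inserting this into \<open>mean_deviation_bound\<close> gives \<open>2 V + 2 V\<close>.
\<close>

lemma chi_sq_broadcast:
  "chi_sq K ({..<D} \<rightarrow>\<^sub>E B) (broadcast K D a)
     \<le> 4 * ((1 + chi_sq K B a / (real (card K) - 1)\<^sup>2) ^ D - 1)"
proof -
  define k where "k = real (card K)"
  define P where "P = ({..<D} \<rightarrow>\<^sub>E B)"
  define A where "A = broadcast K D a"
  define r where "r f = (\<Prod>i<D. mixture K a (f i))" for f
  define M where "M = mixture K A"
  define h where "h i j = (\<Sum>b\<in>B. avoiding K a i b * avoiding K a j b / mixture K a b)" for i j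
  define V where "V = (1 + chi_sq K B a / (k - 1)\<^sup>2) ^ D - 1"
  \<comment> \<open>\<open>T - 1\<close> is the variance of the average likelihood \<open>M / r\<close>.\<close>
  define T where "T = (\<Sum>f\<in>P. (M f)\<^sup>2 / r f)"
  have k: "k \<ge> 2" using card_K by (simp add: k_def)
  have mem: "f i \<in> B" if "f \<in> P" "i < D" for f i
    using that by (auto simp: P_def)
  have r_nonneg: "0 \<le> r f" if "f \<in> P" for f
    unfolding r_def using mem that by (intro prod_nonneg) (auto intro: mixture_nonneg)
  have A_nonneg: "0 \<le> A j f" if "f \<in> P" for j f
    unfolding A_def broadcast_def using mem that by (intro prod_nonneg) (auto intro: avoiding_nonneg)
  have A_zero: "A j f = 0" if f: "f \<in> P" and r0: "r f = 0" for j f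
  proof -
    obtain i where i: "i < D" "mixture K a (f i) = 0" using r0 by (auto simp: r_def)
    have "avoiding K a j (f i) = 0"
      using mixture_zero_imp[OF mem[OF f i(1)] i(2)] by (simp add: avoiding_def)
    then show ?thesis using i by (auto simp: A_def broadcast_def)
  qed
  have r_total: "(\<Sum>f\<in>P. r f) = 1"
    unfolding P_def r_def by (simp add: sum_prod_PiE finite_B mixture_total)
  have A_total: "(\<Sum>f\<in>P. A j f) = 1" if "j \<in> K" for j
    unfolding P_def A_def broadcast_def using that
    by (simp add: sum_prod_PiE finite_B avoiding_total)
  have AA: "(\<Sum>f\<in>P. A i f * A j f / r f) = h i j ^ D" for i j
  proof -
    have "(\<Sum>f\<in>P. A i f * A j f / r f)
        = (\<Sum>f\<in>P. \<Prod>n<D. avoiding K a i (f n) * avoiding K a j (f n) / mixture K a (f n))"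
      by (simp add: A_def r_def broadcast_def prod.distrib prod_dividef)
    also have "\<dots> = h i j ^ D"
      unfolding P_def h_def by (rule sum_prod_PiE[OF finite_B])
    finally show ?thesis .
  qed
  have h_diag: "h j j ^ D = 1 + V" if "j \<in> K" for j
    using that by (simp add: h_def avoiding_overlap overlap_diag V_def k_def)
  have h_off: "h i j ^ D \<le> 1" if "i \<in> K" "j \<in> K" "i \<noteq> j" for i j
  proof (intro power_le_one)
    show "0 \<le> h i j"
      unfolding h_def
      by (intro sum_nonneg divide_nonneg_nonneg mult_nonneg_nonneg avoiding_nonneg mixture_nonneg)
    show "h i j \<le> 1"
      using overlap_off_le_1[OF that] that by (simp add: h_def avoiding_overlap divide_le_0_iff)
  qed
  have M_eq: "M f = (\<Sum>j\<in>K. A j f) / k" for f by (simp add: M_def mixture_def k_def)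
  have M_total: "(\<Sum>f\<in>P. M f) = 1"
  proof -
    have "(\<Sum>f\<in>P. M f) = (\<Sum>j\<in>K. \<Sum>f\<in>P. A j f) / k"
      unfolding M_eq by (subst sum.swap) (simp add: sum_divide_distrib)
    then show ?thesis using k by (simp add: A_total k_def)
  qed
  have T_upper: "T \<le> 1 + V / k"
  proof -
    have "k\<^sup>2 * T = (\<Sum>f\<in>P. (\<Sum>i\<in>K. \<Sum>j\<in>K. A i f * A j f / r f))"
    proof -
      have "k\<^sup>2 * ((M f)\<^sup>2 / r f) = (\<Sum>i\<in>K. A i f) * (\<Sum>j\<in>K. A j f) / r f" for f
        unfolding M_eq using k by (simp add: power2_eq_square)
      moreover have "(\<Sum>i\<in>K. A i f) * (\<Sum>j\<in>K. A j f) / r f = (\<Sum>i\<in>K. \<Sum>j\<in>K. A i f * A j f / r f)" for f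
        unfolding sum_product by (simp only: sum_divide_distrib)
      ultimately show ?thesis by (simp only: T_def sum_distrib_left)
    qed
    also have "\<dots> = (\<Sum>i\<in>K. \<Sum>j\<in>K. h i j ^ D)"
      by (subst sum.swap, intro sum.cong refl, subst sum.swap) (simp add: AA)
    also have "\<dots> \<le> (\<Sum>i\<in>K. V + k)"
    proof (intro sum_mono)
      fix i assume i: "i \<in> K"
      have "(\<Sum>j\<in>K. h i j ^ D) = h i i ^ D + (\<Sum>j\<in>K - {i}. h i j ^ D)"
        by (rule sum.remove[OF finite_K i])
      also have "\<dots> \<le> (1 + V) + (\<Sum>j\<in>K - {i}. 1)"
        using i h_off by (intro add_mono sum_mono) (auto simp: h_diag)
      also have "\<dots> = V + k" using i card_K by (simp add: k_def of_nat_diff)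
      finally show "(\<Sum>j\<in>K. h i j ^ D) \<le> V + k" .
    qed
    also have "\<dots> = k\<^sup>2 * (1 + V / k)"
      using k by (simp add: k_def field_simps power2_eq_square)
    finally show ?thesis using k by simp
  qed
  have T_lower: "1 \<le> T"
  proof -
    have "0 \<le> (\<Sum>f\<in>P. (M f - r f)\<^sup>2 / r f)"
      by (intro sum_nonneg divide_nonneg_nonneg r_nonneg) auto
    also have "\<dots> = (\<Sum>f\<in>P. (M f)\<^sup>2 / r f - 2 * M f + r f)"
    proof (intro sum.cong refl)
      fix f assume f: "f \<in> P"
      show "(M f - r f)\<^sup>2 / r f = (M f)\<^sup>2 / r f - 2 * M f + r f"
      proof (cases "r f = 0")
        case True
        then show ?thesis by (simp add: M_eq A_zero[OF f True])
      next
        case False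
        then show ?thesis by (simp add: field_simps power2_eq_square)
      qed
    qed
    also have "\<dots> = T - 1"
      by (simp add: T_def sum.distrib sum_subtractf M_total r_total flip: sum_distrib_left)
    finally show ?thesis by simp
  qed
  have "chi_sq K P A = (\<Sum>f\<in>P. (\<Sum>j\<in>K. (A j f)\<^sup>2) / k / M f - M f)"
    unfolding chi_sq_def overlap_def
    by (subst sum.swap)
       (simp add: sum_subtractf M_total[unfolded M_def] power2_eq_square k_def M_def sum_divide_distrib
          mult.commute)
  also have "\<dots> \<le> (\<Sum>f\<in>P. 2 * ((\<Sum>j\<in>K. (A j f)\<^sup>2) / k / r f - (M f)\<^sup>2 / r f)
                        + 2 * k * ((M f)\<^sup>2 / r f - 2 * M f + r f))"
  proof (intro sum_mono)
    fix f assume f: "f \<in> P"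
    have "K \<noteq> {}" using card_K by auto
    then show "(\<Sum>j\<in>K. (A j f)\<^sup>2) / k / M f - M f
        \<le> 2 * ((\<Sum>j\<in>K. (A j f)\<^sup>2) / k / r f - (M f)\<^sup>2 / r f)
          + 2 * k * ((M f)\<^sup>2 / r f - 2 * M f + r f)"
      using mean_deviation_bound[OF finite_K, of "\<lambda>j. A j f" "r f"]
        A_nonneg[OF f] r_nonneg[OF f] A_zero[OF f]
      by (simp add: M_eq k_def)
  qed
  also have "\<dots> = 2 * ((\<Sum>j\<in>K. \<Sum>f\<in>P. A j f * A j f / r f) / k - T) + 2 * k * (T - 1)"
  proof -
    define u where "u f = (\<Sum>j\<in>K. (A j f)\<^sup>2) / k / r f" for f
    define v where "v f = (M f)\<^sup>2 / r f" for f
    have u_total: "(\<Sum>j\<in>K. \<Sum>f\<in>P. A j f * A j f / r f) / k = (\<Sum>f\<in>P. u f)"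
      by (subst sum.swap) (simp add: u_def power2_eq_square sum_divide_distrib mult.commute)
    have "(\<Sum>f\<in>P. 2 * (u f - v f) + 2 * k * (v f - 2 * M f + r f))
        = 2 * ((\<Sum>f\<in>P. u f) - T) + 2 * k * (T - 2 * (\<Sum>f\<in>P. M f) + (\<Sum>f\<in>P. r f))"
      unfolding T_def v_def[symmetric]
      by (simp add: sum.distrib sum_subtractf flip: sum_distrib_left)
    then show ?thesis
      by (simp add: u_total u_def v_def M_total r_total mult.commute)
  qed
  also have "\<dots> = 2 * (1 + V - T) + 2 * k * (T - 1)"
    using k by (simp add: AA h_diag k_def)
  also have "\<dots> \<le> 2 * V + 2 * k * (V / k)"
    using T_lower T_upper k by (intro add_mono mult_left_mono) auto
  also have "\<dots> = 4 * V" using k by simp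
  finally show ?thesis unfolding P_def A_def V_def k_def .
qed

end

section \<open>The law of the leaves given the root color\<close>

definition leaf_configs :: "nat \<Rightarrow> nat \<Rightarrow> nat \<Rightarrow> (nat list \<Rightarrow> nat) set" where
  "leaf_configs D k l = tree_leaves D l \<rightarrow>\<^sub>E {1..k}"

definition branch :: "(nat list \<Rightarrow> nat) \<Rightarrow> nat \<Rightarrow> nat list \<Rightarrow> nat" where
  "branch \<sigma> i = (\<lambda>v. \<sigma> (i # v))"

definition graft :: "nat \<Rightarrow> nat \<Rightarrow> (nat \<Rightarrow> nat list \<Rightarrow> nat) \<Rightarrow> nat list \<Rightarrow> nat" where
  "graft D j f = (\<lambda>v. case v of [] \<Rightarrow> j | i # w \<Rightarrow> if i < D then f i w else undefined)"

text \<open>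
  The probability that a uniform coloring with root color \<open>j\<close> shows \<open>\<eta>\<close> on the leaves. The
  recursion says that the subtrees of the children are independent given the root color; that it
  counts colorings correctly is \<open>card_extensions_eq_leaf_law\<close> below.
\<close>

primrec leaf_law :: "nat \<Rightarrow> nat \<Rightarrow> nat \<Rightarrow> nat \<Rightarrow> (nat list \<Rightarrow> nat) \<Rightarrow> real" where
  "leaf_law D k 0 j \<eta> = (if \<eta> [] = j then 1 else 0)"
| "leaf_law D k (Suc l) j \<eta> = broadcast {1..k} D (leaf_law D k l) j (branch \<eta>)"

lemma branch_graft: "i < D \<Longrightarrow> branch (graft D j f) i = f i"
  by (simp add: branch_def graft_def)

lemma graft_Nil: "graft D j f [] = j"
  by (simp add: graft_def)

lemma Cons_in_tree_verts: "i # v \<in> tree_verts D (Suc l) \<longleftrightarrow> i < D \<and> v \<in> tree_verts D l"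
  by (auto simp: tree_verts_def)

lemma Cons_in_tree_leaves: "i # v \<in> tree_leaves D (Suc l) \<longleftrightarrow> i < D \<and> v \<in> tree_leaves D l"
  by (auto simp: tree_leaves_def Cons_in_tree_verts)

lemma Nil_in_tree_verts: "[] \<in> tree_verts D l"
  by (simp add: tree_verts_def)

lemma Nil_notin_tree_leaves: "[] \<notin> tree_leaves D (Suc l)"
  by (simp add: tree_leaves_def)

lemma tree_verts_0: "tree_verts D 0 = {[]}" and tree_leaves_0: "tree_leaves D 0 = {[]}"
  by (auto simp: tree_verts_def tree_leaves_def)

lemma finite_tree_leaves: "finite (tree_leaves D l)"
proof -
  have "finite (tree_verts D l)"
    unfolding tree_verts_def by (rule finite_lists_length_le) simp
  then show ?thesis by (rule rev_finite_subset) (auto simp: tree_leaves_def)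
qed

lemma finite_leaf_configs: "finite (leaf_configs D k l)"
  unfolding leaf_configs_def by (intro finite_PiE finite_tree_leaves) auto

text \<open>
  The leaves of the tree of depth \<open>l + 1\<close> are the disjoint union of the leaves of the \<open>D\<close> branches,
  so a leaf configuration is a family of \<open>D\<close> leaf configurations of depth \<open>l\<close>. The root is not a
  leaf, so \<open>graft\<close> restores the value \<open>undefined\<close> there.
\<close>

lemma bij_betw_branches:
  "bij_betw (\<lambda>\<eta>. restrict (branch \<eta>) {..<D})
     (leaf_configs D k (Suc l)) ({..<D} \<rightarrow>\<^sub>E leaf_configs D k l)"
proof (intro bij_betw_byWitness[where f' = "graft D undefined"] ballI)
  fix \<eta> assume "\<eta> \<in> leaf_configs D k (Suc l)"
  then have "\<eta> v = undefined" if "v \<notin> tree_leaves D (Suc l)" for v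
    using that by (auto simp: leaf_configs_def PiE_def extensional_def)
  then show "graft D undefined (restrict (branch \<eta>) {..<D}) = \<eta>"
    using Nil_notin_tree_leaves
    by (auto simp: fun_eq_iff graft_def branch_def Cons_in_tree_leaves split: list.split)
next
  fix f assume "f \<in> {..<D} \<rightarrow>\<^sub>E leaf_configs D k l"
  then show "restrict (branch (graft D undefined f)) {..<D} = f"
    by (auto simp: fun_eq_iff branch_graft PiE_def extensional_def)
next
  show "(\<lambda>\<eta>. restrict (branch \<eta>) {..<D}) ` leaf_configs D k (Suc l)
      \<subseteq> {..<D} \<rightarrow>\<^sub>E leaf_configs D k l"
    by (auto simp: leaf_configs_def branch_def PiE_iff Cons_in_tree_leaves extensional_def)
next
  show "graft D undefined ` ({..<D} \<rightarrow>\<^sub>E leaf_configs D k l) \<subseteq> leaf_configs D k (Suc l)"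
    by (auto simp: leaf_configs_def graft_def PiE_iff Cons_in_tree_leaves extensional_def
          Nil_notin_tree_leaves split: list.split if_splits)
qed

lemma sum_leaf_configs_Suc:
  "(\<Sum>\<eta>\<in>leaf_configs D k (Suc l). F (restrict (branch \<eta>) {..<D}))
     = (\<Sum>f\<in>{..<D} \<rightarrow>\<^sub>E leaf_configs D k l. F f)"
  by (rule sum.reindex_bij_betw[OF bij_betw_branches])

lemma leaf_law_Suc:
  "leaf_law D k (Suc l) j \<eta>
     = broadcast {1..k} D (leaf_law D k l) j (restrict (branch \<eta>) {..<D})"
  by (simp add: broadcast_def)

lemma overlap_leaf_law_Suc:
  "overlap {1..k} (leaf_configs D k (Suc l)) (leaf_law D k (Suc l)) i j
     = overlap {1..k} ({..<D} \<rightarrow>\<^sub>E leaf_configs D k l) (broadcast {1..k} D (leaf_law D k l)) i j"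
proof -
  let ?b = "broadcast {1..k} D (leaf_law D k l)"
  show ?thesis
    unfolding overlap_def mixture_def leaf_law_Suc
    by (rule sum_leaf_configs_Suc[of "\<lambda>f. ?b i f * ?b j f / ((\<Sum>m\<in>{1..k}. ?b m f) / real (card {1..k}))"])
qed

lemma chi_sq_leaf_law_Suc:
  "chi_sq {1..k} (leaf_configs D k (Suc l)) (leaf_law D k (Suc l))
     = chi_sq {1..k} ({..<D} \<rightarrow>\<^sub>E leaf_configs D k l) (broadcast {1..k} D (leaf_law D k l))"
  by (simp only: chi_sq_def overlap_leaf_law_Suc)

lemma leaf_configs_0_sum:
  "(\<Sum>\<eta>\<in>leaf_configs D k 0. g (\<eta> [])) = (\<Sum>c\<in>{1..k}. g c)"
proof (rule sum.reindex_bij_betw)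
  show "bij_betw (\<lambda>\<eta>. \<eta> []) (leaf_configs D k 0) {1..k}"
    by (rule bij_betw_byWitness[where f' = "\<lambda>c. \<lambda>v\<in>{[]}. c"])
       (auto simp: leaf_configs_def tree_leaves_0 fun_eq_iff PiE_iff extensional_def split: if_splits)
qed

lemma channel_leaf_law:
  assumes "2 \<le> k"
  shows "channel {1..k} (leaf_configs D k l) (leaf_law D k l)"
proof (induction l)
  case 0
  show ?case
  proof
    fix j assume "j \<in> {1..k}"
    then show "(\<Sum>\<eta>\<in>leaf_configs D k 0. leaf_law D k 0 j \<eta>) = 1"
      using leaf_configs_0_sum[of "\<lambda>c. if c = j then 1 else 0 :: real"] by simp
  qed (use assms in \<open>auto simp: finite_leaf_configs\<close>)
next
  case (Suc l)
  interpret channel "{1..k}" "leaf_configs D k l" "leaf_law D k l" by fact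
  show ?case
  proof
    fix j \<eta> assume \<eta>: "\<eta> \<in> leaf_configs D k (Suc l)"
    then have "branch \<eta> i \<in> leaf_configs D k l" if "i < D" for i
      using bij_betwE[OF bij_betw_branches] that by fastforce
    then show "0 \<le> leaf_law D k (Suc l) j \<eta>"
      unfolding leaf_law.simps broadcast_def by (intro prod_nonneg ballI avoiding_nonneg) simp
  next
    fix j assume j: "j \<in> {1..k}"
    have "(\<Sum>\<eta>\<in>leaf_configs D k (Suc l). leaf_law D k (Suc l) j \<eta>)
        = (\<Sum>f\<in>{..<D} \<rightarrow>\<^sub>E leaf_configs D k l. broadcast {1..k} D (leaf_law D k l) j f)"
      unfolding leaf_law_Suc
      by (rule sum_leaf_configs_Suc[of "broadcast {1..k} D (leaf_law D k l) j"])
    also have "\<dots> = (\<Sum>\<eta>\<in>leaf_configs D k l. avoiding {1..k} (leaf_law D k l) j \<eta>) ^ D"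
      unfolding broadcast_def by (rule sum_prod_PiE[OF finite_leaf_configs])
    also have "\<dots> = 1"
      by (simp only: avoiding_total[OF j] power_one)
    finally show "(\<Sum>\<eta>\<in>leaf_configs D k (Suc l). leaf_law D k (Suc l) j \<eta>) = 1" .
  qed (use assms in \<open>auto simp: finite_leaf_configs\<close>)
qed

text \<open>
  Exchangeability of the leaf laws comes from permuting the colors of the leaves.
\<close>

definition recolor :: "nat \<Rightarrow> nat \<Rightarrow> (nat \<Rightarrow> nat) \<Rightarrow> (nat list \<Rightarrow> nat) \<Rightarrow> nat list \<Rightarrow> nat" where
  "recolor D l \<pi> \<eta> = restrict (\<pi> \<circ> \<eta>) (tree_leaves D l)"

lemma leaf_law_recolor:
  assumes "bij_betw \<pi> {1..k} {1..k}" "inj \<pi>" "j \<in> {1..k}"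
  shows "leaf_law D k l (\<pi> j) (recolor D l \<pi> \<eta>) = leaf_law D k l j \<eta>"
  using assms(3)
proof (induction l arbitrary: j \<eta>)
  case 0
  then show ?case using assms(2) by (auto simp: recolor_def tree_leaves_0 inj_eq)
next
  case (Suc l)
  have "avoiding {1..k} (leaf_law D k l) (\<pi> j) (branch (recolor D (Suc l) \<pi> \<eta>) i)
      = avoiding {1..k} (leaf_law D k l) j (branch \<eta> i)" if "i < D" for i
  proof -
    have br: "branch (recolor D (Suc l) \<pi> \<eta>) i = recolor D l \<pi> (branch \<eta> i)"
      using that by (auto simp: fun_eq_iff branch_def recolor_def Cons_in_tree_leaves)
    have "bij_betw \<pi> ({1..k} - {j}) ({1..k} - {\<pi> j})"
      using bij_betw_DiffI[OF assms(1), of "{j}" "{\<pi> j}"] bij_betwE[OF assms(1)] Suc.prems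
      by auto
    then have "(\<Sum>m\<in>{1..k} - {\<pi> j}. leaf_law D k l m (recolor D l \<pi> (branch \<eta> i)))
        = (\<Sum>m\<in>{1..k} - {j}. leaf_law D k l (\<pi> m) (recolor D l \<pi> (branch \<eta> i)))"
      by (rule sum.reindex_bij_betw[symmetric])
    also have "\<dots> = (\<Sum>m\<in>{1..k} - {j}. leaf_law D k l m (branch \<eta> i))"
      by (intro sum.cong refl Suc.IH) auto
    finally show ?thesis by (simp add: avoiding_def br)
  qed
  then show ?case by (simp add: broadcast_def)
qed

lemma bij_betw_recolor:
  assumes "\<And>c. c \<in> {1..k} \<Longrightarrow> \<pi> c \<in> {1..k}" "\<And>c. \<pi> (\<pi> c) = c"
  shows "bij_betw (recolor D l \<pi>) (leaf_configs D k l) (leaf_configs D k l)"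
proof -
  have maps: "recolor D l \<pi> \<eta> \<in> leaf_configs D k l" if "\<eta> \<in> leaf_configs D k l" for \<eta>
    unfolding leaf_configs_def
  proof (rule PiE_I)
    fix v assume v: "v \<in> tree_leaves D l"
    then have "\<eta> v \<in> {1..k}" using that unfolding leaf_configs_def by (rule PiE_mem[rotated])
    then show "recolor D l \<pi> \<eta> v \<in> {1..k}"
      using assms(1) v by (simp only: recolor_def restrict_apply comp_apply if_True)
  qed (simp add: recolor_def)
  have inv: "recolor D l \<pi> (recolor D l \<pi> \<eta>) = \<eta>" if "\<eta> \<in> leaf_configs D k l" for \<eta>
  proof
    fix v show "recolor D l \<pi> (recolor D l \<pi> \<eta>) v = \<eta> v"
      using that assms(2) PiE_arb[of \<eta> "tree_leaves D l" _ v]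
      by (cases "v \<in> tree_leaves D l") (auto simp: recolor_def leaf_configs_def)
  qed
  show ?thesis
    by (rule bij_betw_byWitness[where f' = "recolor D l \<pi>"]) (use maps inv in auto)
qed

lemma overlap_leaf_law_transpose:
  fixes D k l x y :: nat
  defines "\<pi> \<equiv> Transposition.transpose x y"
  assumes xy: "x \<in> {1..k}" "y \<in> {1..k}" and "i \<in> {1..k}" "j \<in> {1..k}"
  shows "overlap {1..k} (leaf_configs D k l) (leaf_law D k l) (\<pi> i) (\<pi> j)
       = overlap {1..k} (leaf_configs D k l) (leaf_law D k l) i j"
proof -
  let ?K = "{1..k}" and ?B = "leaf_configs D k l" and ?a = "leaf_law D k l"
  have inv: "\<pi> (\<pi> c) = c" for c by (simp add: \<pi>_def)
  have into: "\<pi> c \<in> ?K" if "c \<in> ?K" for c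
    using that xy by (auto simp: \<pi>_def Transposition.transpose_def)
  have bij: "bij_betw \<pi> ?K ?K"
    by (rule bij_betw_byWitness[where f' = \<pi>]) (use inv into in auto)
  have inj: "inj \<pi>" by (metis inv injI)
  note recolor = leaf_law_recolor[OF bij inj]
  have bij_r: "bij_betw (recolor D l \<pi>) ?B ?B"
    by (rule bij_betw_recolor[OF into inv])
  have mix: "mixture ?K ?a (recolor D l \<pi> \<eta>) = mixture ?K ?a \<eta>" for \<eta>
    unfolding mixture_def
    using sum.reindex_bij_betw[OF bij, of "\<lambda>j. ?a j (recolor D l \<pi> \<eta>)"]
    by (simp only: recolor cong: sum.cong)
  have "overlap ?K ?B ?a (\<pi> i) (\<pi> j)
      = (\<Sum>\<eta>\<in>?B. ?a (\<pi> i) (recolor D l \<pi> \<eta>) * ?a (\<pi> j) (recolor D l \<pi> \<eta>)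
                   / mixture ?K ?a (recolor D l \<pi> \<eta>))"
    unfolding overlap_def
    by (rule sum.reindex_bij_betw[OF bij_r, symmetric])
  also have "\<dots> = overlap ?K ?B ?a i j"
    unfolding overlap_def mix by (simp only: recolor[OF assms(4)] recolor[OF assms(5)])
  finally show ?thesis .
qed

lemma exchangeable_leaf_law:
  assumes "2 \<le> k"
  shows "exchangeable_channel {1..k} (leaf_configs D k l) (leaf_law D k l)"
proof -
  interpret channel "{1..k}" "leaf_configs D k l" "leaf_law D k l"
    by (rule channel_leaf_law[OF assms])
  show ?thesis
  proof
    fix i j assume ij: "i \<in> {1..k}" "j \<in> {1..k}"
    show "overlap {1..k} (leaf_configs D k l) (leaf_law D k l) i i
             = overlap {1..k} (leaf_configs D k l) (leaf_law D k l) j j"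
      using overlap_leaf_law_transpose[OF ij ij(2,2), of D l]
      by (simp only: transpose_apply_second)
  next
    fix i j j'
    assume ij: "i \<in> {1..k}" "j \<in> {1..k}" "j' \<in> {1..k}" and neq: "i \<noteq> j" "i \<noteq> j'"
    show "overlap {1..k} (leaf_configs D k l) (leaf_law D k l) i j
             = overlap {1..k} (leaf_configs D k l) (leaf_law D k l) i j'"
      using overlap_leaf_law_transpose[OF ij(2,3,1,3), of D l]
      by (simp only: transpose_apply_second transpose_apply_other[OF neq])
  qed
qed

lemma chi_sq_leaf_law_0:
  assumes "2 \<le> k"
  shows "chi_sq {1..k} (leaf_configs D k 0) (leaf_law D k 0) = real k - 1"
proof -
  interpret exchangeable_channel "{1..k}" "leaf_configs D k 0" "leaf_law D k 0"
    by (rule exchangeable_leaf_law[OF assms])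
  have one: "1 \<in> {1..k}" using assms by simp
  have mix: "mixture {1..k} (leaf_law D k 0) \<eta> = 1 / real k" if "\<eta> [] \<in> {1..k}" for \<eta>
    using that by (simp add: mixture_def)
  have "overlap {1..k} (leaf_configs D k 0) (leaf_law D k 0) 1 1
      = (\<Sum>\<eta>\<in>leaf_configs D k 0. if \<eta> [] = 1 then real k else 0)"
    unfolding overlap_def
  proof (intro sum.cong refl)
    fix \<eta> assume "\<eta> \<in> leaf_configs D k 0"
    then have "\<eta> [] \<in> {1..k}"
      unfolding leaf_configs_def tree_leaves_0 by (rule PiE_mem) simp
    then show "leaf_law D k 0 1 \<eta> * leaf_law D k 0 1 \<eta> / mixture {1..k} (leaf_law D k 0) \<eta>
        = (if \<eta> [] = 1 then real k else 0)"
      by (simp only: mix leaf_law.simps) simp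
  qed
  also have "\<dots> = (\<Sum>c\<in>{1..k}. if c = 1 then real k else 0)"
    by (rule leaf_configs_0_sum)
  also have "\<dots> = real k"
    using one by (simp only: sum.delta finite_atLeastAtMost if_True)
  finally show ?thesis unfolding overlap_diag[OF one] by linarith
qed

text \<open>
  Convexity of the exponential turns the nonlinear recursion for the divergence into a linear one,
  from the very first level on.
\<close>

lemma exp_minus_one_le_chord:
  fixes t s :: real
  assumes "0 \<le> t" "t \<le> 1"
  shows "exp (t * s) - 1 \<le> t * (exp s - 1)"
proof -
  have "exp ((1 - t) *\<^sub>R 0 + t *\<^sub>R s) \<le> (1 - t) * exp 0 + t * exp s"
    by (rule convex_onD[OF exp_convex]) (use assms in auto)
  then show ?thesis by (simp add: right_diff_distrib)
qed

text \<open>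
  Write the divergence as \<open>(k - 1) * t\<close>. Then \<open>t = 1\<close> at depth \<open>0\<close>, and one level maps \<open>t\<close> to at
  most \<open>4 / (k - 1) * (exp (t * D / (k - 1)) - 1)\<close>, which is at most \<open>\<rho> * t\<close> for
  \<open>0 \<le> t \<le> 1\<close>.
\<close>

lemma chi_sq_leaf_law_bound:
  fixes D k l :: nat
  defines "\<rho> \<equiv> 4 / (real k - 1) * (exp (real D / (real k - 1)) - 1)"
  assumes k: "2 \<le> k" and \<rho>: "\<rho> \<le> 1"
  shows "chi_sq {1..k} (leaf_configs D k l) (leaf_law D k l) \<le> (real k - 1) * \<rho> ^ l"
proof (induction l)
  case 0
  show ?case by (simp only: chi_sq_leaf_law_0[OF k] power_0 mult_1_right)
next
  case (Suc l)
  interpret exchangeable_channel "{1..k}" "leaf_configs D k l" "leaf_law D k l"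
    by (rule exchangeable_leaf_law[OF k])
  define x where "x = chi_sq {1..k} (leaf_configs D k l) (leaf_law D k l)"
  define q where "q = real k - 1"
  define t where "t = x / q"
  have q: "q \<ge> 1" using k by (simp add: q_def)
  have \<rho>_eq: "\<rho> = 4 / q * (exp (real D / q) - 1)" by (simp only: \<rho>_def q_def)
  have \<rho>0: "0 \<le> \<rho>" using q by (simp add: \<rho>_eq)
  have x0: "0 \<le> x" unfolding x_def by (rule chi_sq_nonneg)
  then have t0: "0 \<le> t" using q by (simp add: t_def)
  have t_le: "t \<le> \<rho> ^ l" using Suc.IH q by (simp add: t_def x_def q_def divide_le_eq mult.commute)
  then have t1: "t \<le> 1" using power_le_one[OF \<rho>0 \<rho>, of l] by simp
  have "chi_sq {1..k} (leaf_configs D k (Suc l)) (leaf_law D k (Suc l))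
      \<le> 4 * ((1 + x / q\<^sup>2) ^ D - 1)"
    using chi_sq_broadcast[of D] unfolding chi_sq_leaf_law_Suc x_def q_def card_atLeastAtMost
    by (simp only: diff_Suc_1)
  also have "\<dots> \<le> 4 * (exp (t * (real D / q)) - 1)"
  proof -
    have "(1 + x / q\<^sup>2) ^ D \<le> exp (x / q\<^sup>2) ^ D"
      using x0 by (intro power_mono exp_ge_add_one_self) simp
    also have "\<dots> = exp (t * (real D / q))"
      by (simp add: t_def power2_eq_square mult.commute flip: exp_of_nat_mult)
    finally show ?thesis by simp
  qed
  also have "\<dots> \<le> 4 * (t * (exp (real D / q) - 1))"
    by (intro mult_left_mono exp_minus_one_le_chord t0 t1) simp
  also have "\<dots> = q * (\<rho> * t)" using q by (simp add: \<rho>_eq)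
  also have "\<dots> \<le> q * (\<rho> * \<rho> ^ l)"
    using q \<rho>0 t_le by (intro mult_left_mono) auto
  finally show ?case by (simp only: q_def power_Suc)
qed

section \<open>Counting colorings with prescribed root and leaves\<close>

lemma tree_edges_Suc:
  "tree_edges D (Suc l)
     = {([], [i]) | i. i < D} \<union> {(i # v, i # w) | i v w. i < D \<and> (v, w) \<in> tree_edges D l}"
proof (intro set_eqI iffI)
  fix e assume "e \<in> tree_edges D (Suc l)"
  then obtain v i where e: "e = (v, v @ [i])" "v \<in> tree_verts D (Suc l)" "length v < Suc l" "i < D"
    by (auto simp: tree_edges_def)
  then show "e \<in> {([], [i]) | i. i < D} \<union> {(i # v, i # w) | i v w. i < D \<and> (v, w) \<in> tree_edges D l}"
    by (cases v) (auto simp: tree_edges_def Cons_in_tree_verts)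
next
  fix e
  assume "e \<in> {([], [i]) | i. i < D} \<union> {(i # v, i # w) | i v w. i < D \<and> (v, w) \<in> tree_edges D l}"
  then show "e \<in> tree_edges D (Suc l)"
  proof
    assume "e \<in> {([], [i]) | i. i < D}"
    then show ?thesis using Nil_in_tree_verts by (auto simp: tree_edges_def)
  next
    assume "e \<in> {(i # v, i # w) | i v w. i < D \<and> (v, w) \<in> tree_edges D l}"
    then obtain i v m where "e = (i # v, (i # v) @ [m])" "i < D" "v \<in> tree_verts D l" "length v < l" "m < D"
      by (auto simp: tree_edges_def)
    then show ?thesis
      unfolding tree_edges_def by (intro CollectI exI[of _ "i # v"] exI[of _ m]) (simp add: Cons_in_tree_verts)
  qed
qed

lemma tree_colorings_Suc:
  "\<sigma> \<in> tree_colorings D k (Suc l) \<longleftrightarrow>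
     \<sigma> \<in> extensional (tree_verts D (Suc l)) \<and> \<sigma> [] \<in> {1..k} \<and>
     (\<forall>i<D. branch \<sigma> i \<in> tree_colorings D k l \<and> branch \<sigma> i [] \<noteq> \<sigma> [])"
proof -
  have split_verts: "(\<forall>v\<in>tree_verts D (Suc l). P v)
      \<longleftrightarrow> P [] \<and> (\<forall>i<D. \<forall>v\<in>tree_verts D l. P (i # v))" for P
  proof (intro iffI ballI)
    fix v assume P: "P [] \<and> (\<forall>i<D. \<forall>v\<in>tree_verts D l. P (i # v))"
      and v: "v \<in> tree_verts D (Suc l)"
    then show "P v" by (cases v) (auto simp: Cons_in_tree_verts)
  qed (use Nil_in_tree_verts in \<open>auto simp: Cons_in_tree_verts\<close>)
  have split_edges: "(\<forall>(v, w)\<in>tree_edges D (Suc l). \<sigma> v \<noteq> \<sigma> w)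
      \<longleftrightarrow> (\<forall>i<D. \<sigma> [] \<noteq> \<sigma> [i] \<and> (\<forall>(v, w)\<in>tree_edges D l. \<sigma> (i # v) \<noteq> \<sigma> (i # w)))"
    unfolding tree_edges_Suc by fast
  have ext: "branch \<sigma> i \<in> extensional (tree_verts D l)"
    if "\<sigma> \<in> extensional (tree_verts D (Suc l))" "i < D" for i
    using that by (auto simp: extensional_def branch_def Cons_in_tree_verts)
  show ?thesis
    unfolding tree_colorings_def mem_Collect_eq PiE_iff split_verts split_edges
    using ext by (auto simp: branch_def)
qed

definition extensions :: "nat \<Rightarrow> nat \<Rightarrow> nat \<Rightarrow> nat \<Rightarrow> (nat list \<Rightarrow> nat) \<Rightarrow> (nat list \<Rightarrow> nat) set" where
  "extensions D k l j \<eta> =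
     {\<sigma> \<in> tree_colorings D k l. \<sigma> [] = j \<and> restrict \<sigma> (tree_leaves D l) = \<eta>}"

lemma finite_extensions: "finite (extensions D k l j \<eta>)"
  using finite_tree_colorings by (simp add: extensions_def)

lemma restrict_leaves_Suc_eq_iff:
  assumes "\<eta> \<in> extensional (tree_leaves D (Suc l))"
  shows "restrict \<sigma> (tree_leaves D (Suc l)) = \<eta>
     \<longleftrightarrow> (\<forall>i<D. restrict (branch \<sigma> i) (tree_leaves D l) = branch \<eta> i)"
proof
  assume "restrict \<sigma> (tree_leaves D (Suc l)) = \<eta>"
  then have \<eta>: "\<eta> = restrict \<sigma> (tree_leaves D (Suc l))" by (rule sym)
  show "\<forall>i<D. restrict (branch \<sigma> i) (tree_leaves D l) = branch \<eta> i"
    unfolding \<eta> by (auto simp: fun_eq_iff branch_def Cons_in_tree_leaves)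
next
  assume br: "\<forall>i<D. restrict (branch \<sigma> i) (tree_leaves D l) = branch \<eta> i"
  show "restrict \<sigma> (tree_leaves D (Suc l)) = \<eta>"
  proof
    fix v
    show "restrict \<sigma> (tree_leaves D (Suc l)) v = \<eta> v"
    proof (cases "v \<in> tree_leaves D (Suc l)")
      case False
      then show ?thesis using assms by (simp add: extensional_def)
    next
      case True
      then obtain i w where v: "v = i # w" "i < D" "w \<in> tree_leaves D l"
        using Nil_notin_tree_leaves Cons_in_tree_leaves by (cases v) auto
      then have "restrict (branch \<sigma> i) (tree_leaves D l) w = branch \<eta> i w" using br by metis
      then show ?thesis using True v by (simp add: branch_def)
    qed
  qed
qed

text \<open>
  Once root and leaves are prescribed, the branches can be colored independently; the root
  only forbids its own color at the roots of the branches.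
\<close>

lemma bij_betw_extensions:
  assumes j: "j \<in> {1..k}" and \<eta>: "\<eta> \<in> leaf_configs D k (Suc l)"
  shows "bij_betw (\<lambda>\<sigma>. restrict (branch \<sigma>) {..<D}) (extensions D k (Suc l) j \<eta>)
           (PiE {..<D} (\<lambda>i. \<Union>m\<in>{1..k} - {j}. extensions D k l m (branch \<eta> i)))"
    (is "bij_betw ?r ?S ?T")
proof -
  have S: "\<sigma> \<in> ?S \<longleftrightarrow> \<sigma> \<in> extensional (tree_verts D (Suc l)) \<and> \<sigma> [] = j \<and>
      (\<forall>i<D. branch \<sigma> i \<in> (\<Union>m\<in>{1..k} - {j}. extensions D k l m (branch \<eta> i)))" for \<sigma>
  proof -
    have ext: "\<eta> \<in> extensional (tree_leaves D (Suc l))"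
      using \<eta> by (simp add: leaf_configs_def PiE_def)
    have root: "\<sigma>' [] \<in> {1..k}" if "\<sigma>' \<in> tree_colorings D k l" for \<sigma>'
      using that Nil_in_tree_verts unfolding tree_colorings_def by blast
    show ?thesis
      unfolding extensions_def mem_Collect_eq tree_colorings_Suc restrict_leaves_Suc_eq_iff[OF ext]
      using j root by blast
  qed
  show ?thesis
  proof (intro bij_betw_byWitness[where f' = "graft D j"] ballI subsetI)
    fix \<sigma> assume "\<sigma> \<in> ?S"
    then have "\<sigma> [] = j" and ext: "\<And>v. v \<notin> tree_verts D (Suc l) \<Longrightarrow> \<sigma> v = undefined"
      unfolding S by (auto simp: extensional_def)
    then show "graft D j (?r \<sigma>) = \<sigma>"
      by (auto simp: fun_eq_iff graft_def branch_def Cons_in_tree_verts split: list.split)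
  next
    fix f assume f: "f \<in> ?T"
    then show "?r (graft D j f) = f"
      by (auto simp: fun_eq_iff branch_graft PiE_def extensional_def)
  next
    fix f assume "f \<in> ?r ` ?S"
    then show "f \<in> ?T" by (auto simp: S PiE_iff)
  next
    fix \<sigma> assume "\<sigma> \<in> graft D j ` ?T"
    then obtain f where f: "f \<in> ?T" and \<sigma>: "\<sigma> = graft D j f" by blast
    have fi: "f i \<in> (\<Union>m\<in>{1..k} - {j}. extensions D k l m (branch \<eta> i))" if "i < D" for i
      using f that by (auto simp: PiE_iff)
    then have "f i v = undefined" if "i < D" "v \<notin> tree_verts D l" for i v
      using that by (fastforce simp: extensions_def tree_colorings_def PiE_iff extensional_def)
    then have "\<sigma> \<in> extensional (tree_verts D (Suc l))"
      by (auto simp: \<sigma> extensional_def graft_def Cons_in_tree_verts Nil_in_tree_verts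
               split: list.split)
    moreover have "branch \<sigma> i = f i" if "i < D" for i
      unfolding \<sigma> by (rule branch_graft[OF that])
    ultimately show "\<sigma> \<in> ?S"
      unfolding S using fi graft_Nil[of D j f, folded \<sigma>] by metis
  qed
qed

lemma card_extensions_Suc:
  assumes "j \<in> {1..k}" and "\<eta> \<in> leaf_configs D k (Suc l)"
  shows "card (extensions D k (Suc l) j \<eta>)
       = (\<Prod>i<D. \<Sum>m\<in>{1..k} - {j}. card (extensions D k l m (branch \<eta> i)))"
proof -
  have "card (\<Union>m\<in>{1..k} - {j}. extensions D k l m \<eta>')
      = (\<Sum>m\<in>{1..k} - {j}. card (extensions D k l m \<eta>'))" for \<eta>'
    by (intro card_UN_disjoint) (auto simp: finite_extensions, auto simp: extensions_def)
  then show ?thesis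
    using bij_betw_same_card[OF bij_betw_extensions[OF assms]] by (simp only: card_PiE finite_lessThan)
qed

lemma branch_in_leaf_configs:
  assumes "\<eta> \<in> leaf_configs D k (Suc l)" "i < D"
  shows "branch \<eta> i \<in> leaf_configs D k l"
proof -
  have "restrict (branch \<eta>) {..<D} \<in> {..<D} \<rightarrow>\<^sub>E leaf_configs D k l"
    by (rule bij_betwE[OF bij_betw_branches, rule_format, OF assms(1)])
  from PiE_mem[OF this, of i] show ?thesis using assms(2) by simp
qed

text \<open>
  The factor \<open>M\<close> is the number of colorings with a given root color.
\<close>

lemma card_extensions_eq_leaf_law:
  assumes k: "2 \<le> k"
  shows "\<exists>M>0. \<forall>j\<in>{1..k}. \<forall>\<eta>\<in>leaf_configs D k l.
           real (card (extensions D k l j \<eta>)) = M * leaf_law D k l j \<eta>"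
proof (induction l)
  case 0
  have "tree_edges D 0 = {}" by (simp add: tree_edges_def)
  then have colorings: "tree_colorings D k 0 = leaf_configs D k 0"
    by (simp add: tree_colorings_def leaf_configs_def tree_verts_0 tree_leaves_0)
  have restr: "restrict \<sigma> {[]} = \<sigma>" if "\<sigma> \<in> leaf_configs D k 0" for \<sigma>
    using that unfolding leaf_configs_def tree_leaves_0 by (rule PiE_restrict)
  have "real (card (extensions D k 0 j \<eta>)) = 1 * leaf_law D k 0 j \<eta>"
    if "\<eta> \<in> leaf_configs D k 0" for j \<eta>
  proof -
    have "\<sigma> \<in> extensions D k 0 j \<eta> \<longleftrightarrow> \<sigma> = \<eta> \<and> \<eta> [] = j" for \<sigma>
      unfolding extensions_def colorings tree_leaves_0 mem_Collect_eq using restr that by metis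
    then have "extensions D k 0 j \<eta> = (if \<eta> [] = j then {\<eta>} else {})"
      by (simp add: set_eq_iff)
    then show ?thesis by (simp only: leaf_law.simps) simp
  qed
  then show ?case by (intro exI[of _ 1] conjI zero_less_one ballI)
next
  case (Suc l)
  then obtain M where M: "M > 0" and IH: "\<And>j \<eta>. j \<in> {1..k} \<Longrightarrow> \<eta> \<in> leaf_configs D k l \<Longrightarrow>
      real (card (extensions D k l j \<eta>)) = M * leaf_law D k l j \<eta>" by blast
  define q where "q = real k - 1"
  have q: "q > 0" using k by (simp add: q_def)
  have "real (card (extensions D k (Suc l) j \<eta>)) = (M * q) ^ D * leaf_law D k (Suc l) j \<eta>"
    if j: "j \<in> {1..k}" and \<eta>: "\<eta> \<in> leaf_configs D k (Suc l)" for j \<eta>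
  proof -
    have "real (card (extensions D k (Suc l) j \<eta>))
        = (\<Prod>i<D. \<Sum>m\<in>{1..k} - {j}. real (card (extensions D k l m (branch \<eta> i))))"
      unfolding card_extensions_Suc[OF j \<eta>] by simp
    also have "\<dots> = (\<Prod>i<D. M * q * avoiding {1..k} (leaf_law D k l) j (branch \<eta> i))"
    proof (intro prod.cong refl)
      fix i assume "i \<in> {..<D}"
      then have br: "branch \<eta> i \<in> leaf_configs D k l" using branch_in_leaf_configs[OF \<eta>] by simp
      have "(\<Sum>m\<in>{1..k} - {j}. real (card (extensions D k l m (branch \<eta> i))))
          = (\<Sum>m\<in>{1..k} - {j}. M * leaf_law D k l m (branch \<eta> i))"
        by (intro sum.cong refl IH br) blast
      also have "\<dots> = M * q * avoiding {1..k} (leaf_law D k l) j (branch \<eta> i)"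
        using q unfolding avoiding_def card_atLeastAtMost diff_Suc_1 q_def[symmetric]
        by (simp flip: sum_distrib_left)
      finally show "(\<Sum>m\<in>{1..k} - {j}. real (card (extensions D k l m (branch \<eta> i))))
          = M * q * avoiding {1..k} (leaf_law D k l) j (branch \<eta> i)" .
    qed
    also have "\<dots> = (M * q) ^ D * leaf_law D k (Suc l) j \<eta>"
      unfolding leaf_law.simps broadcast_def prod.distrib by (simp add: power_mult_distrib)
    finally show ?thesis .
  qed
  moreover have "(M * q) ^ D > 0" using M q by simp
  ultimately show ?case by blast
qed

section \<open>From the divergence to the root marginal\<close>

context exchangeable_channel
begin

text \<open>
  Cauchy-Schwarz with respect to the mixture, which has total mass one.
\<close>

lemma sum_abs_deviation_le:
  assumes "c \<in> K"
  shows "(\<Sum>b\<in>B. \<bar>a c b - mixture K a b\<bar>) \<le> sqrt (chi_sq K B a)"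
proof (rule real_le_rsqrt)
  let ?m = "mixture K a"
  have "\<bar>a c b - ?m b\<bar> = sqrt (?m b) * (\<bar>a c b - ?m b\<bar> / sqrt (?m b))" if "b \<in> B" for b
    using mixture_zero_imp[OF that _ assms] by (cases "?m b = 0") auto
  then have "(\<Sum>b\<in>B. \<bar>a c b - ?m b\<bar>)\<^sup>2
      = (\<Sum>b\<in>B. sqrt (?m b) * (\<bar>a c b - ?m b\<bar> / sqrt (?m b)))\<^sup>2"
    by (intro arg_cong[where f = "\<lambda>x. x\<^sup>2"] sum.cong refl)
  also have "\<dots> \<le> (\<Sum>b\<in>B. (sqrt (?m b))\<^sup>2) * (\<Sum>b\<in>B. (\<bar>a c b - ?m b\<bar> / sqrt (?m b))\<^sup>2)"
    by (rule Cauchy_Schwarz_ineq_sum)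
  also have "\<dots> = (\<Sum>b\<in>B. ?m b) * (\<Sum>b\<in>B. (a c b - ?m b)\<^sup>2 / ?m b)"
    by (intro arg_cong2[where f = "(*)"] sum.cong refl)
       (simp_all add: power_divide mixture_nonneg)
  also have "\<dots> = chi_sq K B a"
    unfolding mixture_total overlap_diag_expand[OF assms] overlap_diag[OF assms] by simp
  finally show "(\<Sum>b\<in>B. \<bar>a c b - ?m b\<bar>)\<^sup>2 \<le> chi_sq K B a" .
qed

end

text \<open>
  The posterior of \<open>c\<close> given \<open>\<eta>\<close> is \<open>leaf_law c \<eta> / (k * mixture \<eta>)\<close>, and \<open>\<eta>\<close> itself appears
  with probability \<open>mixture \<eta>\<close>; the product of the deviation with this weight has no denominator.
\<close>

lemma expectation_root_marginal:
  assumes k: "2 \<le> k" and c: "c \<in> {1..k}"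
  shows "measure_pmf.expectation (coloring_pmf D k l) (\<lambda>\<tau>. \<bar>root_marginal D k l c \<tau> - 1 / real k\<bar>)
       = (\<Sum>\<eta>\<in>leaf_configs D k l.
            \<bar>leaf_law D k l c \<eta> - mixture {1..k} (leaf_law D k l) \<eta>\<bar>) / real k"
proof -
  let ?K = "{1..k}" and ?B = "leaf_configs D k l" and ?a = "leaf_law D k l"
  let ?L = "tree_leaves D l" and ?col = "tree_colorings D k l"
  let ?m = "mixture ?K ?a"
  interpret channel ?K ?B ?a by (rule channel_leaf_law[OF k])
  obtain M where M: "M > 0"
    and ext: "\<And>j \<eta>. j \<in> ?K \<Longrightarrow> \<eta> \<in> ?B \<Longrightarrow> real (card (extensions D k l j \<eta>)) = M * ?a j \<eta>"
    using card_extensions_eq_leaf_law[OF k, of D l] by blast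
  define fib where "fib \<eta> = {\<sigma>\<in>?col. restrict \<sigma> ?L = \<eta>}" for \<eta>
  have fin: "finite ?col" and ne: "?col \<noteq> {}"
    using finite_tree_colorings tree_colorings_nonempty[OF k] by auto
  have cardK: "real (card ?K) = real k" by simp
  have kpos: "real k > 0" using k by simp
  have card_fib: "real (card (fib \<eta>)) = M * real k * ?m \<eta>" if \<eta>: "\<eta> \<in> ?B" for \<eta>
  proof -
    have "fib \<eta> = (\<Union>j\<in>?K. extensions D k l j \<eta>)"
      using Nil_in_tree_verts[of D l]
      unfolding fib_def extensions_def tree_colorings_def by blast
    then have "card (fib \<eta>) = (\<Sum>j\<in>?K. card (extensions D k l j \<eta>))"
      by (simp only:) (intro card_UN_disjoint, auto simp: finite_extensions, auto simp: extensions_def)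
    then have "real (card (fib \<eta>)) = (\<Sum>j\<in>?K. M * ?a j \<eta>)"
      by (simp only: of_nat_sum ext[OF _ \<eta>] cong: sum.cong)
    also have "\<dots> = M * (real k * ?m \<eta>)"
      using sum_eq_mixture[of \<eta>] unfolding cardK by (simp only: sum_distrib_left[symmetric])
    finally show ?thesis by (simp only: mult.assoc)
  qed
  have maps: "restrict \<sigma> ?L \<in> ?B" if "\<sigma> \<in> ?col" for \<sigma>
    using that by (auto simp: tree_colorings_def leaf_configs_def tree_leaves_def PiE_iff)
  have group: "(\<Sum>\<eta>\<in>?B. \<Sum>\<sigma>\<in>fib \<eta>. g \<sigma>) = (\<Sum>\<sigma>\<in>?col. g \<sigma>)" for g :: "_ \<Rightarrow> real"
    unfolding fib_def using fin finite_leaf_configs by (rule sum.group) (use maps in blast)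
  have card_col: "real (card ?col) = M * real k"
  proof -
    have "real (card ?col) = (\<Sum>\<eta>\<in>?B. real (card (fib \<eta>)))"
      using group[of "\<lambda>_. 1"] by simp
    also have "\<dots> = M * real k * (\<Sum>\<eta>\<in>?B. ?m \<eta>)"
      by (simp only: card_fib sum_distrib_left cong: sum.cong)
    finally show ?thesis by (simp only: mixture_total mult_1_right)
  qed
  have marginal: "root_marginal D k l c \<tau> = ?a c \<eta> / (real k * ?m \<eta>)"
    if \<eta>: "\<eta> \<in> ?B" and \<tau>: "\<tau> \<in> fib \<eta>" for \<tau> \<eta>
  proof -
    have eta: "restrict \<tau> ?L = \<eta>" using \<tau> by (simp add: fib_def)
    have "root_marginal D k l c \<tau>
        = real (card (extensions D k l c \<eta>)) / real (card ?col) / (real (card (fib \<eta>)) / real (card ?col))"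
      unfolding root_marginal_def cond_prob_def coloring_pmf_def eta
      using ne fin
      by (simp add: measure_pmf_of_set fib_def extensions_def tree_root_def Int_def)
    also have "\<dots> = (M * ?a c \<eta>) / (M * (real k * ?m \<eta>))"
      unfolding card_fib[OF \<eta>] ext[OF c \<eta>] card_col using M kpos by simp
    finally show ?thesis using M by simp
  qed
  have "measure_pmf.expectation (coloring_pmf D k l) (\<lambda>\<tau>. \<bar>root_marginal D k l c \<tau> - 1 / real k\<bar>)
      = (\<Sum>\<tau>\<in>?col. \<bar>root_marginal D k l c \<tau> - 1 / real k\<bar>) / real (card ?col)"
    unfolding coloring_pmf_def by (rule integral_pmf_of_set[OF ne fin])
  also have "(\<Sum>\<tau>\<in>?col. \<bar>root_marginal D k l c \<tau> - 1 / real k\<bar>)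
      = (\<Sum>\<eta>\<in>?B. \<Sum>\<tau>\<in>fib \<eta>. \<bar>root_marginal D k l c \<tau> - 1 / real k\<bar>)"
    by (rule group[symmetric])
  also have "\<dots> = (\<Sum>\<eta>\<in>?B. M * \<bar>?a c \<eta> - ?m \<eta>\<bar>)"
  proof (intro sum.cong refl)
    fix \<eta> assume \<eta>: "\<eta> \<in> ?B"
    have "(\<Sum>\<tau>\<in>fib \<eta>. \<bar>root_marginal D k l c \<tau> - 1 / real k\<bar>)
        = (\<Sum>\<tau>\<in>fib \<eta>. \<bar>?a c \<eta> / (real k * ?m \<eta>) - 1 / real k\<bar>)"
      by (intro sum.cong refl) (simp only: marginal[OF \<eta>])
    also have "\<dots> = M * (real k * ?m \<eta>) * \<bar>?a c \<eta> / (real k * ?m \<eta>) - 1 / real k\<bar>"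
      unfolding sum_constant card_fib[OF \<eta>] by (simp only: mult.assoc)
    also have "\<dots> = M * \<bar>?a c \<eta> - ?m \<eta>\<bar>"
    proof (cases "?m \<eta> = 0")
      case True
      then show ?thesis using mixture_zero_imp[OF \<eta> True c] by (simp only:) simp
    next
      case False
      define x where "x = real k * ?m \<eta>"
      have "?m \<eta> > 0" using False mixture_nonneg[OF \<eta>] by linarith
      then have x: "x > 0" unfolding x_def using kpos by (rule mult_pos_pos[rotated])
      have "x * \<bar>?a c \<eta> / x - 1 / real k\<bar> = \<bar>x * (?a c \<eta> / x - 1 / real k)\<bar>"
        using x by (simp only: abs_mult abs_of_pos)
      also have "x * (?a c \<eta> / x - 1 / real k) = ?a c \<eta> - x / real k"
        using x by (simp add: right_diff_distrib)
      also have "x / real k = ?m \<eta>" using kpos by (simp add: x_def)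
      finally show ?thesis unfolding x_def[symmetric] by (simp only: mult.assoc)
    qed
    finally show "(\<Sum>\<tau>\<in>fib \<eta>. \<bar>root_marginal D k l c \<tau> - 1 / real k\<bar>) = M * \<bar>?a c \<eta> - ?m \<eta>\<bar>" .
  qed
  also have "(\<Sum>\<eta>\<in>?B. M * \<bar>?a c \<eta> - ?m \<eta>\<bar>) = M * (\<Sum>\<eta>\<in>?B. \<bar>?a c \<eta> - ?m \<eta>\<bar>)"
    by (rule sum_distrib_left[symmetric])
  finally show ?thesis
    unfolding card_col using M by (simp only: mult_divide_mult_cancel_left less_imp_neq[symmetric] not_False_eq_True)
qed

section \<open>The number of colors above the threshold\<close>

text \<open>
  Above the threshold, \<open>exp (D / (k - 1))\<close> is at most about \<open>D powr (1 / (1 + \<epsilon>))\<close>, a power of \<open>D\<close> below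
  the first, while \<open>k\<close> is at least \<open>D\<close> up to a logarithm. This is where \<open>C > 1\<close> enters. Half of
  \<open>\<epsilon>\<close> absorbs the difference between \<open>k\<close> and \<open>k - 1\<close>, and the exponent is lowered further to absorb
  the factor \<open>4 * ln D\<close>.
\<close>

lemma contraction_factor_bound:
  assumes \<epsilon>: "0 < \<epsilon>" "\<epsilon> \<le> 1 / 3"
  shows "\<exists>D\<^sub>0::nat. \<forall>D k :: nat. D > D\<^sub>0 \<longrightarrow> real k > (1 + \<epsilon>) * real D / ln (real D) \<longrightarrow>
           1 < D \<and> 2 \<le> k \<and>
           4 / (real k - 1) * (exp (real D / (real k - 1)) - 1) \<le> real D powr (- \<epsilon> / 4)"
proof -
  \<comment> \<open>Chosen such that \<open>x powr (\<epsilon> / 16) \<ge> 64 / \<epsilon>\<close> beyond \<open>X\<close>; this is the factor by which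
      \<open>ln_powr_bound\<close> loses in \<open>4 * ln x\<close>.\<close>
  define X where "X = (64 / \<epsilon>) powr (16 / \<epsilon>)"
  have X: "x > 1 \<and> \<epsilon> / 2 * (x / ln x) \<ge> 1 \<and> 4 * ln x \<le> x powr (\<epsilon> / 8)" if "x > X" for x :: real
  proof -
    have "1 \<le> X" unfolding X_def using \<epsilon> by (intro ge_one_powr_ge_zero) auto
    then have x: "x > 1" using that by linarith
    define h where "h = x powr (\<epsilon> / 16)"
    have "64 / \<epsilon> = X powr (\<epsilon> / 16)" unfolding X_def using \<epsilon> by (simp add: powr_powr)
    also have "\<dots> \<le> h" unfolding h_def using that \<epsilon> \<open>1 \<le> X\<close> by (intro powr_mono2) auto
    finally have h: "64 / \<epsilon> \<le> h" .
    then have h64: "64 \<le> \<epsilon> * h" using \<epsilon> by (simp add: divide_le_eq mult.commute)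
    have h_pos: "0 < h" using x by (simp add: h_def)
    have hh: "h * h = x powr (\<epsilon> / 8)" by (simp add: h_def flip: powr_add)
    have "ln x \<le> h / (\<epsilon> / 16)" unfolding h_def using x \<epsilon> by (intro ln_powr_bound) auto
    then have "4 * ln x \<le> 64 / \<epsilon> * h" by simp
    also have "\<dots> \<le> h * h" using h h_pos by (intro mult_right_mono) auto
    finally have ln4: "4 * ln x \<le> h * h" .
    have "h * h * h = x powr (3 * \<epsilon> / 16)" by (simp add: h_def flip: powr_add)
    also have "\<dots> \<le> x powr 1" using x \<epsilon> by (intro powr_mono) auto
    finally have hhh: "h * h * h \<le> x" using x by simp
    have "64 * (h * h) \<le> \<epsilon> * h * (h * h)" using h64 h_pos by (intro mult_right_mono) auto
    also have "\<dots> = \<epsilon> * (h * h * h)" by simp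
    also have "\<dots> \<le> \<epsilon> * x" using hhh \<epsilon> by (intro mult_left_mono) auto
    finally have "ln x \<le> \<epsilon> / 2 * x" using ln4 mult_pos_pos[OF h_pos h_pos] by linarith
    then have "\<epsilon> / 2 * (x / ln x) \<ge> 1" using x by (simp add: le_divide_eq)
    then show ?thesis using x ln4 unfolding hh by blast
  qed
  show ?thesis
  proof (intro exI[of _ "nat \<lceil>X\<rceil>"] allI impI)
    fix D k :: nat
    assume D: "D > nat \<lceil>X\<rceil>" and k: "real k > (1 + \<epsilon>) * real D / ln (real D)"
    define x where "x = real D"
    define q where "q = real k - 1"
    have "x > X" using D unfolding x_def by linarith
    from X[OF this] have x: "x > 1" and big: "\<epsilon> / 2 * (x / ln x) \<ge> 1" and ln4: "4 * ln x \<le> x powr (\<epsilon> / 8)"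
      by auto
    have ln_pos: "ln x > 0" using x by simp
    define y where "y = x / ln x"
    have y: "y > 0" using x ln_pos by (simp add: y_def)
    have kq: "real k > (1 + \<epsilon>) * y" using k by (simp add: y_def x_def)
    have q: "(1 + \<epsilon> / 2) * y \<le> q"
      using kq big unfolding q_def y_def[symmetric] by (simp add: algebra_simps)
    have y1: "y \<ge> 1"
    proof -
      have "\<epsilon> / 2 * y \<le> 1 * y" using \<epsilon> y by (intro mult_right_mono) auto
      then show ?thesis using big by (simp add: y_def)
    qed
    have q_ge: "y \<le> q"
    proof -
      have "1 * y \<le> (1 + \<epsilon> / 2) * y" using \<epsilon> y by (intro mult_right_mono) auto
      then show ?thesis using q by linarith
    qed
    have k2: "2 \<le> k" using q_ge y1 by (simp add: q_def)
    have "x / q \<le> x / ((1 + \<epsilon> / 2) * y)"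
      using q q_ge y x \<epsilon> by (intro divide_left_mono mult_pos_pos) auto
    also have "\<dots> = ln x / (1 + \<epsilon> / 2)" using x ln_pos by (simp add: y_def)
    finally have "exp (x / q) \<le> x powr (1 / (1 + \<epsilon> / 2))" using x by (simp add: powr_def)
    \<comment> \<open>The value \<open>3 / 8\<close> is \<open>1 / 4\<close> for the claim plus \<open>1 / 8\<close> for the logarithm; it is admissible for
      \<open>\<epsilon> \<le> 2 / 3\<close>.\<close>
    moreover have "1 / (1 + \<epsilon> / 2) \<le> 1 - 3 * \<epsilon> / 8"
    proof -
      have "0 \<le> \<epsilon> * (1 / 8 - 3 * \<epsilon> / 16)" using \<epsilon> by (intro mult_nonneg_nonneg) auto
      then have "1 \<le> (1 - 3 * \<epsilon> / 8) * (1 + \<epsilon> / 2)" by (simp add: algebra_simps)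
      then show ?thesis using \<epsilon> by (simp add: divide_le_eq)
    qed
    ultimately have exp_le: "exp (x / q) \<le> x powr (1 - 3 * \<epsilon> / 8)"
      using x by (meson order_trans powr_mono less_imp_le)
    have "4 / q * (exp (x / q) - 1) \<le> 4 / y * x powr (1 - 3 * \<epsilon> / 8)"
      using q_ge y exp_le x by (intro mult_mono divide_left_mono) auto
    also have "\<dots> = 4 * ln x * (x powr (- 1) * x powr (1 - 3 * \<epsilon> / 8))"
      using x by (simp add: y_def powr_minus field_simps)
    also have "\<dots> \<le> x powr (\<epsilon> / 8) * (x powr (- 1) * x powr (1 - 3 * \<epsilon> / 8))"
      using ln4 by (intro mult_right_mono) auto
    also have "\<dots> = x powr (- \<epsilon> / 4)"
    proof -
      have "\<epsilon> / 8 + (- 1 + (1 - 3 * \<epsilon> / 8)) = - \<epsilon> / 4" by simp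
      then show ?thesis by (simp only: flip: powr_add)
    qed
    finally show "1 < D \<and> 2 \<le> k \<and>
        4 / (real k - 1) * (exp (real D / (real k - 1)) - 1) \<le> real D powr (- \<epsilon> / 4)"
      using k2 x unfolding q_def x_def by simp
  qed
qed

theorem theorem1p2:
  "\<exists>(\<alpha> :: real \<Rightarrow> real) (\<Delta>\<^sub>0 :: real \<Rightarrow> nat) (l\<^sub>0 :: real \<Rightarrow> nat).
     \<forall>(C :: real) (\<epsilon> :: real). C > 1 \<longrightarrow> \<epsilon> = min (C - 1) (1 / 3) \<longrightarrow>
       \<alpha> \<epsilon> > 0 \<and>
       (\<forall>(\<Delta> :: nat) (k :: nat) (c :: nat) (l :: nat).
          \<Delta> > \<Delta>\<^sub>0 \<epsilon> \<longrightarrow> real k > C * real \<Delta> / ln (real \<Delta>) \<longrightarrow> c \<in> {1..k} \<longrightarrow> l > l\<^sub>0 \<epsilon> \<longrightarrow>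
          measure_pmf.expectation (coloring_pmf \<Delta> k l)
            (\<lambda>\<tau>. \<bar>root_marginal \<Delta> k l c \<tau> - 1 / real k\<bar>)
          \<le> real \<Delta> powr (- \<alpha> \<epsilon> * real l))"
proof -
  define good where "good \<epsilon> D\<^sub>0 \<longleftrightarrow>
      (\<forall>D k :: nat. D > D\<^sub>0 \<longrightarrow> real k > (1 + \<epsilon>) * real D / ln (real D) \<longrightarrow>
         1 < D \<and> 2 \<le> k \<and>
         4 / (real k - 1) * (exp (real D / (real k - 1)) - 1) \<le> real D powr (- \<epsilon> / 4))"
    for \<epsilon> and D\<^sub>0 :: nat
  define \<Delta>\<^sub>0 where "\<Delta>\<^sub>0 \<epsilon> = (SOME D\<^sub>0. good \<epsilon> D\<^sub>0)" for \<epsilon>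
  have good: "good \<epsilon> (\<Delta>\<^sub>0 \<epsilon>)" if "0 < \<epsilon>" "\<epsilon> \<le> 1 / 3" for \<epsilon>
    unfolding \<Delta>\<^sub>0_def
    by (rule someI_ex) (use contraction_factor_bound[OF that] in \<open>simp only: good_def\<close>)
  have bound: "measure_pmf.expectation (coloring_pmf D k l)
      (\<lambda>\<tau>. \<bar>root_marginal D k l c \<tau> - 1 / real k\<bar>) \<le> real D powr (- (\<epsilon> / 8) * real l)"
    if C: "C > 1" and \<epsilon>: "\<epsilon> = min (C - 1) (1 / 3)" and D: "D > \<Delta>\<^sub>0 \<epsilon>"
      and k: "real k > C * real D / ln (real D)" and c: "c \<in> {1..k}"
    for C \<epsilon> :: real and D k c l :: nat
  proof -
    have \<epsilon>_pos: "0 < \<epsilon>" "\<epsilon> \<le> 1 / 3" and \<epsilon>_C: "1 + \<epsilon> \<le> C"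
      using C \<epsilon> by (simp_all add: min_def split: if_splits)
    have "(1 + \<epsilon>) * (real D / ln (real D)) \<le> C * (real D / ln (real D))"
      by (intro mult_right_mono \<epsilon>_C) (cases "D = 0", auto)
    then have "real k > (1 + \<epsilon>) * real D / ln (real D)" using k by simp
    then have D1: "1 < D" and k2: "2 \<le> k"
      and rate: "4 / (real k - 1) * (exp (real D / (real k - 1)) - 1) \<le> real D powr (- \<epsilon> / 4)"
      using good[OF \<epsilon>_pos] D unfolding good_def by blast+
    define \<rho> where "\<rho> = 4 / (real k - 1) * (exp (real D / (real k - 1)) - 1)"
    have q: "real k - 1 \<ge> 1" using k2 by simp
    have \<rho>0: "0 \<le> \<rho>" using q by (simp add: \<rho>_def)
    have "real D powr (- \<epsilon> / 4) \<le> real D powr 0"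
      using D1 \<epsilon>_pos by (intro powr_mono) auto
    then have \<rho>1: "\<rho> \<le> 1" using rate D1 by (simp add: \<rho>_def)
    interpret exchangeable_channel "{1..k}" "leaf_configs D k l" "leaf_law D k l"
      by (rule exchangeable_leaf_law[OF k2])
    have "measure_pmf.expectation (coloring_pmf D k l)
        (\<lambda>\<tau>. \<bar>root_marginal D k l c \<tau> - 1 / real k\<bar>)
        \<le> sqrt (chi_sq {1..k} (leaf_configs D k l) (leaf_law D k l)) / real k"
      unfolding expectation_root_marginal[OF k2 c]
      by (intro divide_right_mono sum_abs_deviation_le[OF c]) simp
    also have "\<dots> \<le> sqrt ((real k - 1) * \<rho> ^ l) / real k"
      using chi_sq_leaf_law_bound[OF k2 \<rho>1[unfolded \<rho>_def], of l]
      by (intro divide_right_mono real_sqrt_le_mono) (simp_all only: \<rho>_def of_nat_0_le_iff)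
    also have "\<dots> \<le> sqrt (\<rho> ^ l)"
    proof -
      have "real k \<le> (real k)\<^sup>2" using k2 by (intro self_le_power) auto
      then have "sqrt (real k - 1) \<le> real k"
        by (intro real_le_lsqrt) (use q in linarith)+
      then have "sqrt (real k - 1) * sqrt (\<rho> ^ l) \<le> real k * sqrt (\<rho> ^ l)"
        using \<rho>0 by (intro mult_right_mono) auto
      then show ?thesis using k2 by (simp add: real_sqrt_mult divide_le_eq mult.commute)
    qed
    also have "\<dots> \<le> sqrt ((real D powr (- \<epsilon> / 4)) ^ l)"
      using rate \<rho>0 by (intro real_sqrt_le_mono power_mono) (simp_all add: \<rho>_def)
    also have "\<dots> = real D powr (- (\<epsilon> / 8) * real l)"
    proof -
      have "(real D powr (- \<epsilon> / 4)) ^ l = real D powr (real l * (- \<epsilon> / 4))"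
        using D1 by (intro powr_power) auto
      also have "real l * (- \<epsilon> / 4) = real 2 * (- (\<epsilon> / 8) * real l)" by simp
      also have "real D powr \<dots> = (real D powr (- (\<epsilon> / 8) * real l))\<^sup>2"
        using D1 by (intro powr_power[symmetric]) auto
      finally show ?thesis by simp
    qed
    finally show ?thesis .
  qed
  show ?thesis
  proof (intro exI[of _ "\<lambda>\<epsilon>. \<epsilon> / 8"] exI[of _ \<Delta>\<^sub>0] exI[of _ "\<lambda>_. 0"] allI impI conjI)
    fix C \<epsilon> :: real assume "C > 1" "\<epsilon> = min (C - 1) (1 / 3)"
    then show "\<epsilon> / 8 > 0" by simp
  qed (rule bound)
qed

end
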